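(* Let $n, d \ge 1$ be integers. The set $A(n,d)$ of polynomial automorphisms $F:\mathbb{C}^n\to\mathbb{C}^n$ of degree at most $d$ with $\mathrm{Jac}(F)=1$ is Zariski closed in the affine space $\Omega(n,d)$ of all polynomial mappings $\mathbb{C}^n\to\mathbb{C}^n$ of degree at most $d$.
   Context: A polynomial mapping $F=(F_1,\dots,F_n):\mathbb{C}^n\to\mathbb{C}^n$ has degree at most $d$ if every component $F_i\in\mathbb{C}[x_1,\dots,x_n]$ has total degree at most $d$. $\Omega(n,d)$ denotes the space of all polynomial mappings $\mathbb{C}^n\to\mathbb{C}^n$ of degree at most $d$; it is identified with an affine space $\mathbb{C}^M$ via the coefficients of the components, and the Zariski topology is the one on $\mathbb{C}^M$. $\mathrm{Jac}(F)=\det(\partial F_i/\partial x_j)_{i,j}\in\mathbb{C}[x_1,\dots,x_n]$, and $\mathrm{Jac}(F)=1$ means that it is the constant polynomial $1$. A polynomial automorphism of $\mathbb{C}^n$ is a polynomial mapping $\mathbb{C}^n\to\mathbb{C}^n$ that has a two-sided inverse which is also a polynomial mapping (of any degree). *)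

theory Defs
  imports "HOL-Analysis.Analysis" "HOL-Library.Poly_Mapping"
begin

text \<open>
  A monomial in variables of type \<open>'v\<close> is a finitely supported exponent vector, and a
  polynomial over the complex numbers is a finitely supported function from monomials to
  coefficients.  Multiplication of the latter is convolution, so for any \<open>'v\<close> this type
  is the commutative ring \<open>\<complex>[x_v | v :: 'v]\<close>.
\<close>

type_synonym 'v monomial = "'v \<Rightarrow>\<^sub>0 nat"
type_synonym 'v cpoly = "'v monomial \<Rightarrow>\<^sub>0 complex"

definition mdeg :: "'v monomial \<Rightarrow> nat" where
  "mdeg m = (\<Sum>v\<in>Poly_Mapping.keys m. Poly_Mapping.lookup m v)"

definition total_degree_le :: "nat \<Rightarrow> 'v cpoly \<Rightarrow> bool" where
  "total_degree_le d p \<longleftrightarrow> (\<forall>m\<in>Poly_Mapping.keys p. mdeg m \<le> d)"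

definition poly_eval :: "'v cpoly \<Rightarrow> ('v \<Rightarrow> complex) \<Rightarrow> complex" where
  "poly_eval p a = (\<Sum>m\<in>Poly_Mapping.keys p. Poly_Mapping.lookup p m *
     (\<Prod>v\<in>Poly_Mapping.keys m. a v ^ Poly_Mapping.lookup m v))"

text \<open>
  If \<open>v\<close> does not occur in \<open>m\<close>, the truncated exponent subtraction below is harmless,
  because the new coefficient is then 0.
\<close>

definition partial_deriv :: "'v \<Rightarrow> 'v cpoly \<Rightarrow> 'v cpoly" where
  "partial_deriv v p = (\<Sum>m\<in>Poly_Mapping.keys p.
     Poly_Mapping.single (m - Poly_Mapping.single v 1)
       (of_nat (Poly_Mapping.lookup m v) * Poly_Mapping.lookup p m))"

text \<open>
  The dimension \<open>n\<close> is \<open>CARD('n)\<close>.  A polynomial mapping is given by its tuple of component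
  polynomials; since the complex numbers are infinite, it is the same thing as the map on
  points that it induces.
\<close>

type_synonym 'n polymap = "'n cpoly ^ 'n"

definition polymap_fun :: "'n::finite polymap \<Rightarrow> complex ^ 'n \<Rightarrow> complex ^ 'n" where
  "polymap_fun F x = (\<chi> i. poly_eval (F $ i) (\<lambda>j. x $ j))"

definition polynomial_automorphism :: "'n::finite polymap \<Rightarrow> bool" where
  "polynomial_automorphism F \<longleftrightarrow>
     (\<exists>G :: 'n polymap. polymap_fun G \<circ> polymap_fun F = id \<and> polymap_fun F \<circ> polymap_fun G = id)"

definition Jac :: "'n::finite polymap \<Rightarrow> 'n cpoly" where
  "Jac F = det (\<chi> i j. partial_deriv j (F $ i))"

definition Omega :: "nat \<Rightarrow> 'n::finite polymap set" where
  "Omega d = {F. \<forall>i. total_degree_le d (F $ i)}"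

definition unimodular_automorphisms :: "nat \<Rightarrow> 'n::finite polymap set" where
  "unimodular_automorphisms d = {F \<in> Omega d. polynomial_automorphism F \<and> Jac F = 1}"

text \<open>
  The affine space with coordinates indexed by a finite set \<open>I\<close> is \<open>I \<rightarrow>\<^sub>E UNIV\<close>.  Its Zariski
  closed subsets are the common zero sets of arbitrary families of polynomials in the
  coordinates.
\<close>

definition zariski_closed :: "'v set \<Rightarrow> ('v \<Rightarrow> complex) set \<Rightarrow> bool" where
  "zariski_closed I S \<longleftrightarrow>
     (\<exists>P :: 'v cpoly set. (\<forall>p\<in>P. \<forall>m\<in>Poly_Mapping.keys p. Poly_Mapping.keys m \<subseteq> I) \<and>
        S = {a \<in> I \<rightarrow>\<^sub>E UNIV. \<forall>p\<in>P. poly_eval p a = 0})"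

text \<open>
  The coordinate \<open>(i, m)\<close> of a polynomial mapping is the coefficient of the monomial \<open>m\<close> in
  its \<open>i\<close>-th component.  The last lemma below is the identification of \<open>Omega d\<close> with
  affine space.
\<close>

definition coeff_index :: "nat \<Rightarrow> ('n::finite \<times> 'n monomial) set" where
  "coeff_index d = {(i, m). mdeg m \<le> d}"

definition coeff_point :: "nat \<Rightarrow> 'n::finite polymap \<Rightarrow> ('n \<times> 'n monomial \<Rightarrow> complex)" where
  "coeff_point d F = (\<lambda>(i, m)\<in>coeff_index d. Poly_Mapping.lookup (F $ i) m)"

definition zariski_closed_in_Omega :: "nat \<Rightarrow> 'n::finite polymap set \<Rightarrow> bool" where
  "zariski_closed_in_Omega d S \<longleftrightarrow>
     S \<subseteq> Omega d \<and> zariski_closed (coeff_index d) (coeff_point d ` S)"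

lemma finite_mdeg_le: "finite {m :: 'n::finite monomial. mdeg m \<le> d}"
proof -
  have "Poly_Mapping.lookup m v \<le> d" if m: "mdeg m \<le> d" for m :: "'n monomial" and v
  proof (cases "v \<in> Poly_Mapping.keys m")
    case True
    then have "Poly_Mapping.lookup m v \<le> mdeg m"
      unfolding mdeg_def by (intro member_le_sum) auto
    with m show ?thesis by simp
  qed (simp add: in_keys_iff)
  then have "Poly_Mapping.lookup ` {m :: 'n monomial. mdeg m \<le> d} \<subseteq> UNIV \<rightarrow>\<^sub>E {..d}"
    by auto
  moreover have "finite ((UNIV :: 'n set) \<rightarrow>\<^sub>E {..d})"
    by (intro finite_PiE) auto
  ultimately have "finite (Poly_Mapping.lookup ` {m :: 'n monomial. mdeg m \<le> d})"
    by (rule finite_subset)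
  then show ?thesis
    by (rule finite_imageD) (simp add: inj_on_def poly_mapping_eqI)
qed

lemma finite_coeff_index: "finite (coeff_index d :: ('n::finite \<times> 'n monomial) set)"
proof -
  have "coeff_index d = (UNIV :: 'n set) \<times> {m. mdeg m \<le> d}"
    by (auto simp: coeff_index_def)
  then show ?thesis by (simp add: finite_mdeg_le)
qed

lemma coeff_point_bij_betw:
  "bij_betw (coeff_point d) (Omega d :: 'n::finite polymap set) (coeff_index d \<rightarrow>\<^sub>E UNIV)"
  unfolding bij_betw_def
proof
  show "inj_on (coeff_point d) (Omega d :: 'n polymap set)"
  proof (rule inj_onI)
    fix F G :: "'n polymap"
    assume F: "F \<in> Omega d" and G: "G \<in> Omega d" and eq: "coeff_point d F = coeff_point d G"
    have "Poly_Mapping.lookup (F $ i) m = Poly_Mapping.lookup (G $ i) m" for i m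
    proof (cases "mdeg m \<le> d")
      case True
      with fun_cong[OF eq, of "(i, m)"] show ?thesis
        by (simp add: coeff_point_def coeff_index_def)
    next
      case False
      with F G have "m \<notin> Poly_Mapping.keys (F $ i)" "m \<notin> Poly_Mapping.keys (G $ i)"
        by (auto simp: Omega_def total_degree_le_def)
      then show ?thesis by (simp add: in_keys_iff)
    qed
    then show "F = G" by (simp add: vec_eq_iff poly_mapping_eqI)
  qed
  show "coeff_point d ` (Omega d :: 'n polymap set) = coeff_index d \<rightarrow>\<^sub>E UNIV"
  proof
    show "coeff_point d ` (Omega d :: 'n polymap set) \<subseteq> coeff_index d \<rightarrow>\<^sub>E UNIV"
      by (auto simp: coeff_point_def)
    show "coeff_index d \<rightarrow>\<^sub>E UNIV \<subseteq> coeff_point d ` (Omega d :: 'n polymap set)"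
    proof
      fix a :: "'n \<times> 'n monomial \<Rightarrow> complex" assume a: "a \<in> coeff_index d \<rightarrow>\<^sub>E UNIV"
      define F :: "'n polymap" where
        "F = (\<chi> i. Abs_poly_mapping (\<lambda>m. if mdeg m \<le> d then a (i, m) else 0))"
      have "finite {m. (if mdeg m \<le> d then a (i, m) else 0) \<noteq> 0}" for i
        by (rule finite_subset[OF _ finite_mdeg_le[of d]]) auto
      then have F: "Poly_Mapping.lookup (F $ i) m = (if mdeg m \<le> d then a (i, m) else 0)" for i m
        by (simp add: F_def)
      have "F \<in> Omega d"
        by (auto simp: Omega_def total_degree_le_def in_keys_iff F split: if_splits)
      moreover have "coeff_point d F = a"
        using a by (auto simp: fun_eq_iff coeff_point_def restrict_def coeff_index_def F PiE_def extensional_def)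
      ultimately show "a \<in> coeff_point d ` Omega d" by blast
    qed
  qed
qed

end

theory Submission
  imports Defs "HOL-Computational_Algebra.Polynomial"
begin

text \<open>
  For \<open>Jac F = 1\<close> the components of \<open>F\<close> are algebraically independent: if \<open>q(F) = 0\<close>, the chain
  rule and the invertibility of the Jacobian matrix give \<open>(\<partial>\<^sub>i q)(F) = 0\<close> for all \<open>i\<close>, and one inducts
  on the degree of \<open>q\<close>.

  The degree of the inverse \<open>G\<close> of an automorphism \<open>F\<close> of degree at most \<open>d\<close> is bounded by some \<open>N\<close>
  depending only on \<open>n\<close> and \<open>d\<close>: counting monomials gives a nonzero relation \<open>P(x\<^sub>i, F(x)) = 0\<close> of
  bounded degree, and substituting \<open>x = G(y)\<close> gives \<open>P(G\<^sub>i(y), y) = 0\<close>, which is impossible on a generic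
  line if the degree of \<open>G\<^sub>i\<close> exceeds the degree of \<open>P\<close> in \<open>y\<close>.

  Hence a map \<open>F\<close> with \<open>Jac F = 1\<close> is an automorphism iff every \<open>x\<^sub>i\<close> is a linear combination of the
  products \<open>F\<^sup>m\<close> with \<open>|m| \<le> N\<close>.  These products are linearly independent, so this says that \<open>x\<^sub>i\<close>
  and the \<open>F\<^sup>m\<close> are linearly dependent, which is expressed by the vanishing of polynomials in the
  coefficients of \<open>F\<close>, obtained by fraction-free elimination on the values at arbitrary points.
\<close>

section \<open>Evaluation of polynomials\<close>

definition monomial_eval :: "'v monomial \<Rightarrow> ('v \<Rightarrow> complex) \<Rightarrow> complex" where
  "monomial_eval m a = (\<Prod>v\<in>Poly_Mapping.keys m. a v ^ Poly_Mapping.lookup m v)"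

section \<open>Evaluation as a ring homomorphism; degrees of monomials\<close>

lemma monomial_eval_superset:
  assumes "finite V" "Poly_Mapping.keys m \<subseteq> V"
  shows "monomial_eval m a = (\<Prod>v\<in>V. a v ^ Poly_Mapping.lookup m v)"
  unfolding monomial_eval_def
  by (rule prod.mono_neutral_left) (use assms in \<open>auto simp: in_keys_iff\<close>)

lemma monomial_eval_UNIV:
  "monomial_eval m a = (\<Prod>v\<in>UNIV. a v ^ Poly_Mapping.lookup m v)" for a :: "'v::finite \<Rightarrow> complex"
  by (rule monomial_eval_superset) auto

lemma monomial_eval_0 [simp]: "monomial_eval 0 a = 1"
  by (simp add: monomial_eval_def)

lemma monomial_eval_single [simp]: "monomial_eval (Poly_Mapping.single v k) a = a v ^ k"
  by (simp add: monomial_eval_superset[of "{v}"])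

lemma keys_add_monomial: "Poly_Mapping.keys (m + m') = Poly_Mapping.keys m \<union> Poly_Mapping.keys m'"
  for m m' :: "'v monomial"
  by (auto simp: in_keys_iff lookup_add)

lemma monomial_eval_add: "monomial_eval (m + m') a = monomial_eval m a * monomial_eval m' a"
proof -
  have "monomial_eval k a = (\<Prod>v\<in>Poly_Mapping.keys (m + m'). a v ^ Poly_Mapping.lookup k v)"
    if "k \<in> {m, m', m + m'}" for k
    by (rule monomial_eval_superset) (use that in \<open>auto simp: keys_add_monomial\<close>)
  then show ?thesis by (simp add: lookup_add power_add prod.distrib)
qed

lemma mdeg_superset:
  assumes "finite V" "Poly_Mapping.keys m \<subseteq> V"
  shows "mdeg m = (\<Sum>v\<in>V. Poly_Mapping.lookup m v)"
  unfolding mdeg_def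
  by (rule sum.mono_neutral_left) (use assms in \<open>auto simp: in_keys_iff\<close>)

lemma mdeg_0 [simp]: "mdeg 0 = 0"
  by (simp add: mdeg_def)

lemma mdeg_single [simp]: "mdeg (Poly_Mapping.single v k) = k"
  by (simp add: mdeg_superset[of "{v}"])

lemma mdeg_add: "mdeg (m + m') = mdeg m + mdeg m'"
proof -
  have "mdeg k = (\<Sum>v\<in>Poly_Mapping.keys (m + m'). Poly_Mapping.lookup k v)"
    if "k \<in> {m, m', m + m'}" for k
    by (rule mdeg_superset) (use that in \<open>auto simp: keys_add_monomial\<close>)
  then show ?thesis by (simp add: lookup_add sum.distrib)
qed

lemma poly_eval_superset:
  assumes "finite M" "Poly_Mapping.keys p \<subseteq> M"
  shows "poly_eval p a = (\<Sum>m\<in>M. Poly_Mapping.lookup p m * monomial_eval m a)"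
  unfolding poly_eval_def monomial_eval_def[symmetric]
  by (rule sum.mono_neutral_left) (use assms in \<open>auto simp: in_keys_iff\<close>)

lemma poly_eval_single [simp]: "poly_eval (Poly_Mapping.single m c) a = c * monomial_eval m a"
  by (simp add: poly_eval_superset[of "{m}"])

lemma poly_eval_0 [simp]: "poly_eval 0 a = 0"
  by (simp add: poly_eval_def)

lemma poly_eval_1 [simp]: "poly_eval 1 a = 1"
  by (simp flip: single_one)

lemma poly_eval_add: "poly_eval (p + q) a = poly_eval p a + poly_eval q a"
proof -
  have "poly_eval r a = (\<Sum>m\<in>Poly_Mapping.keys p \<union> Poly_Mapping.keys q. Poly_Mapping.lookup r m * monomial_eval m a)"
    if "r \<in> {p, q, p + q}" for r
    by (rule poly_eval_superset) (use that keys_add[of p q] in auto)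
  then show ?thesis by (simp add: lookup_add distrib_right sum.distrib)
qed

lemma poly_eval_sum: "poly_eval (\<Sum>i\<in>A. p i) a = (\<Sum>i\<in>A. poly_eval (p i) a)"
  by (induction A rule: infinite_finite_induct) (auto simp: poly_eval_add)

lemma poly_eq_sum_single:
  "p = (\<Sum>m\<in>Poly_Mapping.keys p. Poly_Mapping.single m (Poly_Mapping.lookup p m))"
  for p :: "'v cpoly"
  by (rule poly_mapping_eqI) (auto simp: lookup_sum lookup_single when_def in_keys_iff)

lemma poly_eval_mult: "poly_eval (p * q) a = poly_eval p a * poly_eval q a"
proof -
  let ?K = Poly_Mapping.keys and ?c = Poly_Mapping.lookup
  have "p * q = (\<Sum>m\<in>?K p. \<Sum>m'\<in>?K q. Poly_Mapping.single m (?c p m) * Poly_Mapping.single m' (?c q m'))"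
    by (subst (1) poly_eq_sum_single[of p], subst (1) poly_eq_sum_single[of q]) (rule sum_product)
  also have "poly_eval \<dots> a = (\<Sum>m\<in>?K p. \<Sum>m'\<in>?K q. (?c p m * monomial_eval m a) * (?c q m' * monomial_eval m' a))"
    by (simp add: poly_eval_sum mult_single monomial_eval_add mult_ac)
  also have "\<dots> = poly_eval p a * poly_eval q a"
    by (simp add: poly_eval_superset[OF finite_keys order_refl] sum_product)
  finally show ?thesis .
qed

lemma poly_eval_prod: "poly_eval (\<Prod>i\<in>A. p i) a = (\<Prod>i\<in>A. poly_eval (p i) a)"
  by (induction A rule: infinite_finite_induct) (auto simp: poly_eval_mult)

lemma poly_eval_diff: "poly_eval (p - q) a = poly_eval p a - poly_eval q a"
  using poly_eval_add[of "p - q" q a] by simp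

lemma poly_eval_of_int [simp]: "poly_eval (of_int k) a = of_int k"
  by (simp flip: single_of_int)

text \<open>Induction on the set of variables: with all variables but \<open>v\<close> frozen, the
  sum is a univariate polynomial in the value of \<open>v\<close> that vanishes everywhere, so its
  coefficient at exponent \<open>e j v\<close> is 0, and this coefficient is a sum of the same kind
  over \<open>J'\<close>. The exponents are a family over an arbitrary index set, so that the result
  applies both to monomials and to plain exponent functions.\<close>

lemma power_products_independent:
  fixes e :: "'j \<Rightarrow> 'v \<Rightarrow> nat" and c :: "'j \<Rightarrow> complex"
  assumes "finite V" "finite J"
    and "\<And>i j. i \<in> J \<Longrightarrow> j \<in> J \<Longrightarrow> (\<And>v. v \<in> V \<Longrightarrow> e i v = e j v) \<Longrightarrow> i = j"
    and "\<And>y. (\<Sum>j\<in>J. c j * (\<Prod>v\<in>V. y v ^ e j v)) = 0"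
    and "j \<in> J"
  shows "c j = 0"
  using assms
proof (induction V arbitrary: J rule: finite_induct)
  case empty
  then have "J = {j}" by auto
  with empty.prems(3) show ?case by simp
next
  case (insert v V)
  define J' where "J' = {i \<in> J. e i v = e j v}"
  have "(\<Sum>i\<in>J'. c i * (\<Prod>u\<in>V. y u ^ e i u)) = 0" for y
  proof -
    define u where "u = (\<Sum>i\<in>J. monom (c i * (\<Prod>u\<in>V. y u ^ e i u)) (e i v))"
    have "poly u t = 0" for t
    proof -
      have "poly u t = (\<Sum>i\<in>J. c i * (\<Prod>w\<in>insert v V. (y(v := t)) w ^ e i w))"
        unfolding u_def poly_sum poly_monom
      proof (intro sum.cong refl)
        fix i
        have "(\<Prod>w\<in>V. (y(v := t)) w ^ e i w) = (\<Prod>w\<in>V. y w ^ e i w)"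
          using insert.hyps by (intro prod.cong) auto
        then show "c i * (\<Prod>u\<in>V. y u ^ e i u) * t ^ e i v = c i * (\<Prod>w\<in>insert v V. (y(v := t)) w ^ e i w)"
          using insert.hyps by (simp add: mult_ac)
      qed
      then show ?thesis using insert.prems(3) by simp
    qed
    then have "u = 0" using poly_all_0_iff_0 by blast
    then have "0 = coeff u (e j v)" by simp
    also have "\<dots> = (\<Sum>i\<in>J. if e i v = e j v then c i * (\<Prod>u\<in>V. y u ^ e i u) else 0)"
      by (simp add: u_def coeff_sum)
    also have "\<dots> = (\<Sum>i\<in>J'. c i * (\<Prod>u\<in>V. y u ^ e i u))"
      using insert.prems(1) by (simp add: J'_def sum.If_cases Int_def)
    finally show ?thesis by simp
  qed
  moreover have "i = k" if "i \<in> J'" "k \<in> J'" "\<And>w. w \<in> V \<Longrightarrow> e i w = e k w" for i k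
  proof (rule insert.prems(2))
    show "e i w = e k w" if "w \<in> insert v V" for w
      using that \<open>i \<in> J'\<close> \<open>k \<in> J'\<close> \<open>\<And>w. w \<in> V \<Longrightarrow> e i w = e k w\<close> by (auto simp: J'_def)
  qed (use that in \<open>auto simp: J'_def\<close>)
  ultimately show ?case
    using insert.prems(1,4) by (intro insert.IH[of J']) (auto simp: J'_def)
qed

lemma poly_eval_eq_0_imp_0:
  fixes p :: "'v::finite cpoly"
  assumes "\<And>a. poly_eval p a = 0"
  shows "p = 0"
proof (rule poly_mapping_eqI)
  fix m
  have "Poly_Mapping.lookup p m = 0" if "m \<in> Poly_Mapping.keys p"
    using power_products_independent[of UNIV "Poly_Mapping.keys p" Poly_Mapping.lookup "Poly_Mapping.lookup p" m]
      that assms by (auto simp: poly_eval_superset[OF finite_keys order_refl] monomial_eval_UNIV poly_mapping_eqI)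
  then show "Poly_Mapping.lookup p m = Poly_Mapping.lookup 0 m"
    by (auto simp: in_keys_iff)
qed

section \<open>Polynomial maps with Jacobian determinant 1\<close>

lemma monomial_diff_add_single:
  "m - Poly_Mapping.single v 1 + Poly_Mapping.single v 1 = m" if "Poly_Mapping.lookup m v \<noteq> 0"
  for m :: "'v monomial"
proof (rule poly_mapping_eqI)
  fix u show "Poly_Mapping.lookup (m - Poly_Mapping.single v 1 + Poly_Mapping.single v 1) u = Poly_Mapping.lookup m u"
    using that by (cases "u = v") (auto simp: lookup_minus lookup_add lookup_single when_def)
qed

text \<open>Lowering the exponent of \<open>v\<close> is injective on the monomials containing
  \<open>v\<close>, and the other monomials enter with factor 0, so only one summand contributes to
  each coefficient.\<close>

lemma lookup_partial_deriv:
  "Poly_Mapping.lookup (partial_deriv v p) m =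
     of_nat (Poly_Mapping.lookup m v + 1) * Poly_Mapping.lookup p (m + Poly_Mapping.single v 1)"
proof -
  let ?e = "Poly_Mapping.single v (1::nat)"
  let ?r = "of_nat (Poly_Mapping.lookup m v + 1) * Poly_Mapping.lookup p (m + ?e)"
  have shift: "k - ?e = m \<longleftrightarrow> k = m + ?e" if "Poly_Mapping.lookup k v \<noteq> 0" for k
    using monomial_diff_add_single[OF that] by auto
  have "Poly_Mapping.lookup (partial_deriv v p) m =
    (\<Sum>k\<in>Poly_Mapping.keys p. if k = m + ?e then ?r else 0)"
    unfolding partial_deriv_def lookup_sum
  proof (intro sum.cong refl)
    fix k
    show "Poly_Mapping.lookup (Poly_Mapping.single (k - ?e) (of_nat (Poly_Mapping.lookup k v) * Poly_Mapping.lookup p k)) m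
      = (if k = m + ?e then ?r else 0)"
    proof (cases "Poly_Mapping.lookup k v = 0")
      case True
      then have "k \<noteq> m + ?e" by (auto simp: lookup_add)
      with True show ?thesis by simp
    next
      case False
      then show ?thesis using shift[of k] by (auto simp: lookup_single when_def lookup_add)
    qed
  qed
  also have "\<dots> = ?r" by (auto simp: in_keys_iff)
  finally show ?thesis .
qed

lemma poly_eval_partial_deriv:
  "poly_eval (partial_deriv v p) a = (\<Sum>m\<in>Poly_Mapping.keys p. Poly_Mapping.lookup p m *
     (of_nat (Poly_Mapping.lookup m v) * monomial_eval (m - Poly_Mapping.single v 1) a))"
  by (simp add: partial_deriv_def poly_eval_sum mult_ac)

lemma has_field_derivative_monomial_eval:
  fixes m :: "'v::finite monomial" and \<phi> :: "complex \<Rightarrow> 'v \<Rightarrow> complex"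
  assumes "\<And>v. ((\<lambda>t. \<phi> t v) has_field_derivative D v) (at t)"
  shows "((\<lambda>t. monomial_eval m (\<phi> t)) has_field_derivative
    (\<Sum>v\<in>UNIV. of_nat (Poly_Mapping.lookup m v) * monomial_eval (m - Poly_Mapping.single v 1) (\<phi> t) * D v)) (at t)"
proof -
  let ?l = "Poly_Mapping.lookup m"
  have "((\<lambda>t. monomial_eval m (\<phi> t)) has_field_derivative
    (\<Sum>v\<in>UNIV. of_nat (?l v) * (D v * \<phi> t v ^ (?l v - Suc 0)) * (\<Prod>u\<in>UNIV - {v}. \<phi> t u ^ ?l u))) (at t)"
    unfolding monomial_eval_UNIV
    by (intro has_field_derivative_prod DERIV_power assms)
  moreover have "monomial_eval (m - Poly_Mapping.single v 1) (\<phi> t) =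
     \<phi> t v ^ (?l v - Suc 0) * (\<Prod>u\<in>UNIV - {v}. \<phi> t u ^ ?l u)" for v
    unfolding monomial_eval_UNIV
    by (subst prod.remove[of _ v]) (auto simp: lookup_minus lookup_single when_def intro!: prod.cong)
  ultimately show ?thesis by (simp add: mult_ac)
qed

text \<open>The curve \<open>\<phi>\<close> is arbitrary, so the same rule serves for coordinate
  lines, which identify the formal partial derivatives with analytic ones, and for their images
  under \<open>F\<close>, which gives the chain rule for \<open>q(F)\<close>.\<close>

lemma has_field_derivative_poly_eval:
  fixes p :: "'v::finite cpoly" and \<phi> :: "complex \<Rightarrow> 'v \<Rightarrow> complex"
  assumes "\<And>v. ((\<lambda>t. \<phi> t v) has_field_derivative D v) (at t)"
  shows "((\<lambda>t. poly_eval p (\<phi> t)) has_field_derivative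
    (\<Sum>v\<in>UNIV. poly_eval (partial_deriv v p) (\<phi> t) * D v)) (at t)"
proof -
  have "((\<lambda>t. poly_eval p (\<phi> t)) has_field_derivative
    (\<Sum>m\<in>Poly_Mapping.keys p. Poly_Mapping.lookup p m * (\<Sum>v\<in>UNIV. of_nat (Poly_Mapping.lookup m v) *
        monomial_eval (m - Poly_Mapping.single v 1) (\<phi> t) * D v))) (at t)"
    unfolding poly_eval_superset[OF finite_keys order_refl]
    by (intro DERIV_sum DERIV_cmult has_field_derivative_monomial_eval assms)
  also have "(\<Sum>m\<in>Poly_Mapping.keys p. Poly_Mapping.lookup p m * (\<Sum>v\<in>UNIV. of_nat (Poly_Mapping.lookup m v) *
        monomial_eval (m - Poly_Mapping.single v 1) (\<phi> t) * D v)) =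
     (\<Sum>v\<in>UNIV. poly_eval (partial_deriv v p) (\<phi> t) * D v)"
    unfolding poly_eval_partial_deriv sum_distrib_left sum_distrib_right
    by (subst sum.swap) (simp add: mult_ac)
  finally show ?thesis .
qed

lemma has_field_derivative_poly_eval_coordinate:
  fixes p :: "'v::finite cpoly"
  shows "((\<lambda>t. poly_eval p (a(v := t))) has_field_derivative poly_eval (partial_deriv v p) a) (at (a v))"
proof -
  have "((\<lambda>t. (a(v := t)) u) has_field_derivative (if u = v then 1 else 0)) (at (a v))" for u
    by (cases "u = v") auto
  then have "((\<lambda>t. poly_eval p (a(v := t))) has_field_derivative
    (\<Sum>u\<in>UNIV. poly_eval (partial_deriv u p) (a(v := a v)) * (if u = v then 1 else 0))) (at (a v))"
    by (rule has_field_derivative_poly_eval)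
  then show ?thesis by (simp add: if_distrib cong: if_cong)
qed

lemma poly_eval_Jac:
  "poly_eval (Jac F) a = det (\<chi> i j. poly_eval (partial_deriv j (F $ i)) a)"
  by (simp add: Jac_def det_def poly_eval_sum poly_eval_mult poly_eval_prod)

theorem Jac_1_imp_algebraically_independent:
  fixes F :: "'n::finite polymap" and q :: "'n cpoly"
  assumes "Jac F = 1" "\<And>a. poly_eval q (\<lambda>j. poly_eval (F $ j) a) = 0"
  shows "q = 0"
proof -
  \<comment> \<open>The bound on the degree is strict, so that \<open>e = 0\<close> leaves no
    monomials at all.\<close>
  have "q = 0" if "\<forall>m\<in>Poly_Mapping.keys q. mdeg m < e" "\<And>a. poly_eval q (\<lambda>j. poly_eval (F $ j) a) = 0" for e
    using that
  proof (induction e arbitrary: q)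
    case 0
    then have "Poly_Mapping.keys q = {}" by auto
    then show ?case by simp
  next
    case (Suc e)
    have deriv_0: "partial_deriv i q = 0" for i
    proof (rule Suc.IH)
      show "\<forall>m\<in>Poly_Mapping.keys (partial_deriv i q). mdeg m < e"
      proof
        fix m assume "m \<in> Poly_Mapping.keys (partial_deriv i q)"
        then have "m + Poly_Mapping.single i 1 \<in> Poly_Mapping.keys q"
          by (simp add: in_keys_iff lookup_partial_deriv)
        with Suc.prems(1) have "mdeg (m + Poly_Mapping.single i 1) < Suc e" by blast
        then show "mdeg m < e" by (simp add: mdeg_add)
      qed
    next
      fix a
      let ?A = "\<chi> i j. poly_eval (partial_deriv j (F $ i)) a"
      let ?w = "\<chi> i. poly_eval (partial_deriv i q) (\<lambda>j. poly_eval (F $ j) a)"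
      \<comment> \<open>Differentiating \<open>q(F) = 0\<close> along the \<open>k\<close>-th
        coordinate line: the transposed Jacobian matrix annihilates the gradient of \<open>q\<close>
        at \<open>F(a)\<close>.\<close>
      have "(\<Sum>j\<in>UNIV. poly_eval (partial_deriv j q) (\<lambda>j. poly_eval (F $ j) a) *
        poly_eval (partial_deriv k (F $ j)) a) = 0" for k
      proof -
        have "((\<lambda>t. poly_eval q (\<lambda>j. poly_eval (F $ j) (a(k := t)))) has_field_derivative
          (\<Sum>j\<in>UNIV. poly_eval (partial_deriv j q) (\<lambda>j. poly_eval (F $ j) (a(k := a k))) *
             poly_eval (partial_deriv k (F $ j)) a)) (at (a k))"
          by (intro has_field_derivative_poly_eval has_field_derivative_poly_eval_coordinate)
        moreover have "((\<lambda>t. poly_eval q (\<lambda>j. poly_eval (F $ j) (a(k := t)))) has_field_derivative 0) (at (a k))"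
          by (simp add: Suc.prems(2))
        ultimately show ?thesis
          using DERIV_unique by fastforce
      qed
      then have "transpose ?A *v ?w = 0"
        by (simp add: vec_eq_iff matrix_vector_mult_def transpose_def mult.commute)
      moreover have "det (transpose ?A) = 1"
        using poly_eval_Jac[of F a] assms(1) by (simp add: det_transpose)
      then have "invertible (transpose ?A)" by (simp add: invertible_det_nz)
      ultimately have "?w = 0"
        by (meson invertible_left_inverse matrix_left_invertible_ker)
      then show "poly_eval (partial_deriv i q) (\<lambda>j. poly_eval (F $ j) a) = 0"
        by (simp add: vec_eq_iff)
    qed
    \<comment> \<open>In characteristic 0 a polynomial with vanishing partial derivatives is
      constant: the factor in \<open>lookup_partial_deriv\<close> is a positive integer.\<close>
    have lookup_0: "Poly_Mapping.lookup q m = 0" if "m \<noteq> 0" for m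
    proof -
      from that obtain v where v: "Poly_Mapping.lookup m v \<noteq> 0"
        by (metis lookup_zero poly_mapping_eqI)
      define m' where "m' = m - Poly_Mapping.single v 1"
      have "m = m' + Poly_Mapping.single v 1"
        using monomial_diff_add_single[of m v] v by (simp add: m'_def)
      moreover have "Poly_Mapping.lookup q (m' + Poly_Mapping.single v 1) = 0"
        using lookup_partial_deriv[of v q m'] deriv_0[of v] by (simp del: of_nat_add of_nat_Suc)
      ultimately show ?thesis by simp
    qed
    have "Poly_Mapping.keys q \<subseteq> {0}"
      using lookup_0 by (auto simp: in_keys_iff)
    then have "poly_eval q a = Poly_Mapping.lookup q 0" for a
      using poly_eval_superset[of "{0}" q] by simp
    with Suc.prems(2) have "Poly_Mapping.lookup q 0 = 0" by simp
    with lookup_0 show ?case by (metis lookup_zero poly_mapping_eqI)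
  qed
  \<comment> \<open>Inserting 0 keeps the maximum meaningful when \<open>q\<close> has no
    monomials.\<close>
  from this[of "Suc (Max (insert 0 (mdeg ` Poly_Mapping.keys q)))"] assms(2) show ?thesis
    by (simp add: less_Suc_eq_le)
qed

section \<open>Linear dependence of functions by elimination\<close>

text \<open>Dependence is stated for lists, so a function occurring twice makes the list dependent,
  and elimination can recurse on the list. The empty list is independent.\<close>

definition linearly_dependent :: "('x \<Rightarrow> complex) list \<Rightarrow> bool" where
  "linearly_dependent fs \<longleftrightarrow>
     (\<exists>c. (\<exists>b<length fs. c b \<noteq> 0) \<and> (\<forall>x. (\<Sum>b<length fs. c b * (fs ! b) x) = 0))"

text \<open>
  Pivots are not required to be nonzero; the dependence criterion quantifies over all lists of points
  instead.  Only lists of points at least as long as the list of functions give a nontrivial value.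
\<close>

fun eliminant :: "('x \<Rightarrow> complex) list \<Rightarrow> 'x list \<Rightarrow> complex" where
  "eliminant [f] (p # ps) = f p"
| "eliminant (f # g # fs) (p # ps) = eliminant (map (\<lambda>h x. f p * h x - h p * f x) (g # fs)) ps"
| "eliminant _ _ = 0"

lemma linearly_dependent_Cons:
  "linearly_dependent (f # fs) \<longleftrightarrow>
     (\<exists>c0 c. (c0 \<noteq> 0 \<or> (\<exists>b<length fs. c b \<noteq> 0)) \<and>
        (\<forall>x. c0 * f x + (\<Sum>b<length fs. c b * (fs ! b) x) = 0))" (is "?L \<longleftrightarrow> ?R")
proof
  assume ?L
  then obtain c where c: "\<exists>b<length (f # fs). c b \<noteq> 0"
    "\<And>x. (\<Sum>b<length (f # fs). c b * ((f # fs) ! b) x) = 0"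
    by (auto simp: linearly_dependent_def)
  from c(2) have "\<forall>x. c 0 * f x + (\<Sum>b<length fs. c (Suc b) * (fs ! b) x) = 0"
    by (simp only: list.size sum.lessThan_Suc_shift add_Suc_right add_0_right nth_Cons_0 nth_Cons_Suc) auto
  moreover from c(1) have "c 0 \<noteq> 0 \<or> (\<exists>b<length fs. c (Suc b) \<noteq> 0)"
    by (auto simp: less_Suc_eq_0_disj)
  ultimately show ?R
    by (intro exI[of _ "c 0"] exI[of _ "\<lambda>b. c (Suc b)"]) auto
next
  assume ?R
  then obtain c0 c where c: "c0 \<noteq> 0 \<or> (\<exists>b<length fs. c b \<noteq> 0)"
    "\<And>x. c0 * f x + (\<Sum>b<length fs. c b * (fs ! b) x) = 0" by blast
  show ?L
    unfolding linearly_dependent_def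
  proof (intro exI[of _ "case_nat c0 c"] conjI allI)
    show "\<exists>b<length (f # fs). case_nat c0 c b \<noteq> 0"
      using c(1)
    proof
      assume "\<exists>b<length fs. c b \<noteq> 0"
      then obtain b where "b < length fs" "c b \<noteq> 0" by blast
      then show ?thesis by (intro exI[of _ "Suc b"]) simp
    qed (intro exI[of _ 0], simp)
    show "(\<Sum>b<length (f # fs). case_nat c0 c b * ((f # fs) ! b) x) = 0" for x
      using c(2)[of x]
      by (simp only: list.size sum.lessThan_Suc_shift add_Suc_right add_0_right nth_Cons_0 nth_Cons_Suc) simp
  qed
qed

lemma linearly_dependent_zero:
  assumes "fs \<noteq> []" "\<And>f x. f \<in> set fs \<Longrightarrow> f x = 0"
  shows "linearly_dependent fs"
  unfolding linearly_dependent_def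
  using assms by (intro exI[of _ "\<lambda>_. 1"]) (auto intro!: sum.neutral)

text \<open>The map from \<open>h\<close> to \<open>f p * h - h p * f\<close> is linear and kills
  \<open>f\<close>, so the coefficients of \<open>gs\<close> in a relation still give a relation
  afterwards, for any point \<open>p\<close>. If these coefficients all vanish, then
  \<open>f = 0\<close>, and all the eliminated functions are 0.\<close>

lemma linearly_dependent_eliminate:
  assumes "linearly_dependent (f # gs)" "gs \<noteq> []"
  shows "linearly_dependent (map (\<lambda>h x. f p * h x - h p * f x) gs)"
proof -
  let ?n = "length gs" and ?h = "\<lambda>h x. f p * h x - h p * f x"
  from assms(1) obtain c0 c where c: "c0 \<noteq> 0 \<or> (\<exists>b<?n. c b \<noteq> 0)"
    "\<And>x. c0 * f x + (\<Sum>b<?n. c b * (gs ! b) x) = 0"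
    unfolding linearly_dependent_Cons by blast
  show ?thesis
  proof (cases "\<exists>b<?n. c b \<noteq> 0")
    case True
    have sum: "(\<Sum>b<?n. c b * (gs ! b) x) = - (c0 * f x)" for x
      using c(2)[of x] by (metis add.commute eq_neg_iff_add_eq_0)
    have "(\<Sum>b<?n. c b * (map ?h gs ! b) x) = 0" for x
    proof -
      have "(\<Sum>b<?n. c b * (map ?h gs ! b) x) =
          (\<Sum>b<?n. f p * (c b * (gs ! b) x) - f x * (c b * (gs ! b) p))"
        by (intro sum.cong) (auto simp: right_diff_distrib mult_ac)
      also have "\<dots> = f p * (\<Sum>b<?n. c b * (gs ! b) x) - f x * (\<Sum>b<?n. c b * (gs ! b) p)"
        by (simp only: sum_subtractf sum_distrib_left)
      also have "\<dots> = 0" by (simp add: sum)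
      finally show ?thesis .
    qed
    with True show ?thesis
      unfolding linearly_dependent_def length_map by blast
  next
    case False
    then have "(\<Sum>b<?n. c b * (gs ! b) x) = 0" for x by (intro sum.neutral) auto
    with c False have "f x = 0" for x by (metis add.right_neutral mult_eq_0_iff)
    then show ?thesis using assms(2) by (intro linearly_dependent_zero) auto
  qed
qed

text \<open>Expanding a relation between the eliminated functions gives one in which the
  coefficients of \<open>gs\<close> are scaled by \<open>f p\<close>; a nonzero pivot keeps it
  nontrivial.\<close>

lemma linearly_dependent_eliminateD:
  assumes "linearly_dependent (map (\<lambda>h x. f p * h x - h p * f x) gs)" "f p \<noteq> 0"
  shows "linearly_dependent (f # gs)"
proof -
  let ?n = "length gs"
  from assms(1) obtain c where c: "\<exists>b<?n. c b \<noteq> 0"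
    "\<And>x. (\<Sum>b<?n. c b * (map (\<lambda>h x. f p * h x - h p * f x) gs ! b) x) = 0"
    unfolding linearly_dependent_def length_map by blast
  have "- (\<Sum>b<?n. c b * (gs ! b) p) * f x + (\<Sum>b<?n. (f p * c b) * (gs ! b) x) = 0" for x
  proof -
    have "(\<Sum>b<?n. c b * (map (\<lambda>h x. f p * h x - h p * f x) gs ! b) x) =
        (\<Sum>b<?n. (f p * c b) * (gs ! b) x - c b * (gs ! b) p * f x)"
      by (intro sum.cong) (auto simp: right_diff_distrib mult_ac)
    also have "\<dots> = (\<Sum>b<?n. (f p * c b) * (gs ! b) x) - (\<Sum>b<?n. c b * (gs ! b) p) * f x"
      by (simp only: sum_subtractf sum_distrib_right)
    finally show ?thesis using c(2)[of x] by simp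
  qed
  moreover have "\<exists>b<?n. f p * c b \<noteq> 0" using c(1) assms(2) by simp
  ultimately show ?thesis unfolding linearly_dependent_Cons
    by (intro exI[of _ "- (\<Sum>b<?n. c b * (gs ! b) p)"] exI[of _ "\<lambda>b. f p * c b"]) simp
qed

lemma eliminant_eq_0_if_linearly_dependent:
  "linearly_dependent fs \<Longrightarrow> eliminant fs ps = 0"
proof (induction fs ps rule: eliminant.induct)
  case (1 f p ps)
  then show ?case by (auto simp: linearly_dependent_def)
next
  case (2 f g fs p ps)
  then show ?case using linearly_dependent_eliminate[of f "g # fs" p] by simp
qed auto

text \<open>If \<open>f\<close> is nonzero at some \<open>p\<close>, then \<open>p\<close> serves as
  pivot and the shorter list has vanishing eliminants; otherwise \<open>f = 0\<close> is itself a
  relation. The empty list is excluded because its eliminant is 0 by default although it is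
  independent.\<close>

lemma linearly_dependent_if_eliminant_eq_0:
  "fs \<noteq> [] \<Longrightarrow> (\<And>ps. eliminant fs ps = 0) \<Longrightarrow> linearly_dependent fs"
proof (induction "length fs" arbitrary: fs)
  case (Suc n)
  from Suc.hyps(2) obtain f gs where fs: "fs = f # gs" by (cases fs) auto
  show ?case
  proof (cases gs)
    case Nil
    with fs have "f p = 0" for p using Suc.prems(2)[of "[p]"] by simp
    then show ?thesis using fs Nil by (intro linearly_dependent_zero) auto
  next
    case (Cons g hs)
    show ?thesis
    proof (cases "\<exists>p. f p \<noteq> 0")
      case True
      then obtain p where p: "f p \<noteq> 0" by blast
      have "linearly_dependent (map (\<lambda>h x. f p * h x - h p * f x) gs)"
      proof (rule Suc.hyps(1))
        show "eliminant (map (\<lambda>h x. f p * h x - h p * f x) gs) ps = 0" for ps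
          using Suc.prems(2)[of "p # ps"] fs Cons by simp
      qed (use fs Cons Suc.hyps(2) in auto)
      then show ?thesis using p unfolding fs by (rule linearly_dependent_eliminateD)
    next
      case False
      then show ?thesis unfolding fs linearly_dependent_Cons
        by (intro exI[of _ 1] exI[of _ "\<lambda>_. 0"]) auto
    qed
  qed
qed simp

lemma linearly_dependent_iff_eliminant:
  assumes "fs \<noteq> []"
  shows "linearly_dependent fs \<longleftrightarrow> (\<forall>ps. eliminant fs ps = 0)"
  using assms eliminant_eq_0_if_linearly_dependent linearly_dependent_if_eliminant_eq_0 by blast

section \<open>Polynomial functions with prescribed monomials\<close>

text \<open>The set \<open>M\<close> records either a degree bound or a restriction on the
  variables. The closure rules below then produce polynomials without writing them down.\<close>

definition cpoly_function :: "'v monomial set \<Rightarrow> (('v \<Rightarrow> complex) \<Rightarrow> complex) \<Rightarrow> bool" where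
  "cpoly_function M f \<longleftrightarrow> (\<exists>p. Poly_Mapping.keys p \<subseteq> M \<and> (\<forall>a. poly_eval p a = f a))"

lemma cpoly_functionE:
  assumes "cpoly_function M f"
  obtains p where "Poly_Mapping.keys p \<subseteq> M" "\<And>a. poly_eval p a = f a"
  using assms unfolding cpoly_function_def by blast

lemma cpoly_function_poly_eval:
  "Poly_Mapping.keys p \<subseteq> M \<Longrightarrow> cpoly_function M (poly_eval p)"
  unfolding cpoly_function_def by blast

lemma cpoly_function_mono:
  "cpoly_function M f \<Longrightarrow> M \<subseteq> M' \<Longrightarrow> cpoly_function M' f"
  unfolding cpoly_function_def by blast

lemma cpoly_function_const: "0 \<in> M \<Longrightarrow> cpoly_function M (\<lambda>a. c)"
  unfolding cpoly_function_def by (intro exI[of _ "Poly_Mapping.single 0 c"]) auto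

lemma cpoly_function_var:
  "Poly_Mapping.single v 1 \<in> M \<Longrightarrow> cpoly_function M (\<lambda>a. a v)"
  unfolding cpoly_function_def
  by (intro exI[of _ "Poly_Mapping.single (Poly_Mapping.single v 1) 1"]) auto

lemma cpoly_function_add:
  assumes "cpoly_function M f" "cpoly_function M g"
  shows "cpoly_function M (\<lambda>a. f a + g a)"
proof -
  from assms obtain p q where "Poly_Mapping.keys p \<subseteq> M" "\<And>a. poly_eval p a = f a"
    "Poly_Mapping.keys q \<subseteq> M" "\<And>a. poly_eval q a = g a" by (meson cpoly_functionE)
  then show ?thesis
    unfolding cpoly_function_def using keys_add[of p q]
    by (intro exI[of _ "p + q"]) (auto simp: poly_eval_add)
qed

lemma cpoly_function_mult:
  assumes "cpoly_function M f" "cpoly_function M' g"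
    and "\<And>m m'. m \<in> M \<Longrightarrow> m' \<in> M' \<Longrightarrow> m + m' \<in> M''"
  shows "cpoly_function M'' (\<lambda>a. f a * g a)"
proof -
  from assms(1,2) obtain p q where "Poly_Mapping.keys p \<subseteq> M" "\<And>a. poly_eval p a = f a"
    "Poly_Mapping.keys q \<subseteq> M'" "\<And>a. poly_eval q a = g a" by (meson cpoly_functionE)
  then show ?thesis
    unfolding cpoly_function_def using keys_mult[of p q] assms(3)
    by (intro exI[of _ "p * q"]) (fastforce simp: poly_eval_mult)
qed

lemma cpoly_function_cmult:
  "cpoly_function M f \<Longrightarrow> cpoly_function M (\<lambda>a. c * f a)"
  by (rule cpoly_function_mult[OF cpoly_function_const[of "{0}"]]) auto

lemma cpoly_function_sum:
  "(\<And>i. i \<in> A \<Longrightarrow> cpoly_function M (f i)) \<Longrightarrow> cpoly_function M (\<lambda>a. \<Sum>i\<in>A. f i a)"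
proof (induction A rule: infinite_finite_induct)
  case (insert i A)
  then show ?case by (simp add: cpoly_function_add)
qed (auto simp: cpoly_function_def intro!: exI[of _ 0])

lemma cpoly_function_diff:
  assumes "cpoly_function M f" "cpoly_function M g"
  shows "cpoly_function M (\<lambda>a. f a - g a)"
  using cpoly_function_add[OF assms(1) cpoly_function_cmult[OF assms(2), of "-1"]] by simp

section \<open>Degree bounds for powers and products\<close>

definition monomials_of_degree_le :: "nat \<Rightarrow> 'v monomial set" where
  "monomials_of_degree_le d = {m. mdeg m \<le> d}"

lemma total_degree_le_iff: "total_degree_le d p \<longleftrightarrow> Poly_Mapping.keys p \<subseteq> monomials_of_degree_le d"
  by (auto simp: total_degree_le_def monomials_of_degree_le_def)

lemma cpoly_function_degree_power:
  assumes "cpoly_function (monomials_of_degree_le d) f"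
  shows "cpoly_function (monomials_of_degree_le (k * d)) (\<lambda>a. f a ^ k)"
proof (induction k)
  case 0
  then show ?case by (auto simp: monomials_of_degree_le_def intro!: cpoly_function_const)
next
  case (Suc k)
  show ?case unfolding power_Suc
    by (rule cpoly_function_mult[OF assms Suc]) (auto simp: monomials_of_degree_le_def mdeg_add)
qed

lemma cpoly_function_degree_prod:
  assumes "\<And>i. i \<in> A \<Longrightarrow> cpoly_function (monomials_of_degree_le (d i)) (f i)"
  shows "cpoly_function (monomials_of_degree_le (\<Sum>i\<in>A. d i)) (\<lambda>a. \<Prod>i\<in>A. f i a)"
  using assms
proof (induction A rule: infinite_finite_induct)
  case (insert i A)
  have "cpoly_function (monomials_of_degree_le (\<Sum>i\<in>insert i A. d i)) (\<lambda>a. f i a * (\<Prod>i\<in>A. f i a))"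
    by (rule cpoly_function_mult[of "monomials_of_degree_le (d i)" _ "monomials_of_degree_le (\<Sum>i\<in>A. d i)"])
      (use insert in \<open>auto simp: monomials_of_degree_le_def mdeg_add\<close>)
  then show ?case using insert.hyps by simp
qed (auto simp: monomials_of_degree_le_def intro!: cpoly_function_const)

section \<open>Polynomials in prescribed variables, determinants and eliminants\<close>

definition monomials_in :: "'v set \<Rightarrow> 'v monomial set" where
  "monomials_in I = {m. Poly_Mapping.keys m \<subseteq> I}"

lemma monomials_in_0 [simp]: "0 \<in> monomials_in I"
  by (simp add: monomials_in_def)

lemma cpoly_function_in_mult:
  assumes "cpoly_function (monomials_in I) f" "cpoly_function (monomials_in I) g"
  shows "cpoly_function (monomials_in I) (\<lambda>a. f a * g a)"
  by (rule cpoly_function_mult[OF assms]) (auto simp: monomials_in_def keys_add_monomial)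

lemma cpoly_function_in_prod:
  "(\<And>i. i \<in> A \<Longrightarrow> cpoly_function (monomials_in I) (f i)) \<Longrightarrow>
    cpoly_function (monomials_in I) (\<lambda>a. \<Prod>i\<in>A. f i a)"
proof (induction A rule: infinite_finite_induct)
  case (insert i A)
  then show ?case by (simp add: cpoly_function_in_mult)
qed (auto intro: cpoly_function_const)

lemma cpoly_function_in_power:
  "cpoly_function (monomials_in I) f \<Longrightarrow> cpoly_function (monomials_in I) (\<lambda>a. f a ^ k)"
  using cpoly_function_in_prod[of "{..<k}" I "\<lambda>_. f"] by simp

lemma cpoly_function_in_det:
  fixes A :: "('v \<Rightarrow> complex) \<Rightarrow> complex ^ 'n ^ 'n"
  assumes "\<And>i j. cpoly_function (monomials_in I) (\<lambda>a. A a $ i $ j)"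
  shows "cpoly_function (monomials_in I) (\<lambda>a. det (A a))"
  unfolding det_def
  by (intro cpoly_function_sum cpoly_function_cmult cpoly_function_in_prod assms)

text \<open>Here \<open>a\<close> is the parameter in which polynomiality is claimed, while the
  points \<open>x\<close> stay fixed. An elimination step uses only products and differences of
  values at such points.\<close>

lemma cpoly_function_in_eliminant:
  assumes "\<And>f x. f \<in> set fs \<Longrightarrow> cpoly_function (monomials_in I) (\<lambda>a. f a x)"
  shows "cpoly_function (monomials_in I) (\<lambda>a. eliminant (map (\<lambda>f. f a) fs) ps)"
  using assms
proof (induction ps arbitrary: fs)
  case Nil
  have "eliminant gs [] = 0" for gs :: "('x \<Rightarrow> complex) list" by (cases gs rule: remdups_adj.cases) auto
  then show ?case by (simp add: cpoly_function_const)
next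
  case (Cons p ps)
  show ?case
  \<comment> \<open>This rule splits lists by length 0, 1 or at least 2, as the equations of
    \<open>eliminant\<close> do.\<close>
  proof (cases fs rule: remdups_adj.cases)
    case 1
    then show ?thesis by (simp add: cpoly_function_const)
  next
    case (2 f)
    then show ?thesis using Cons.prems by simp
  next
    case (3 f g gs)
    let ?fs = "map (\<lambda>h a x. f a p * h a x - h a p * f a x) (g # gs)"
    have "cpoly_function (monomials_in I) (\<lambda>a. eliminant (map (\<lambda>f. f a) ?fs) ps)"
    proof (rule Cons.IH)
      fix k x assume "k \<in> set ?fs"
      then obtain h where h: "h \<in> set (g # gs)" "k = (\<lambda>a x. f a p * h a x - h a p * f a x)"
        unfolding set_map by (elim imageE)
      have "f \<in> set fs" "h \<in> set fs" using h(1) 3 by auto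
      then show "cpoly_function (monomials_in I) (\<lambda>a. k a x)"
        unfolding h(2) by (intro cpoly_function_diff cpoly_function_in_mult Cons.prems)
    qed
    then show ?thesis by (simp add: 3 comp_def)
  qed
qed

section \<open>The degree of the inverse\<close>

text \<open>Gaussian elimination: one equation is solved for an unknown \<open>k\<close> with
  nonzero coefficient, which removes one equation and one unknown.\<close>

lemma nontrivial_solution:
  fixes A :: "'i \<Rightarrow> 'j \<Rightarrow> 'a::field"
  assumes "finite I" "finite J" "card I < card J"
  shows "\<exists>c. (\<exists>j\<in>J. c j \<noteq> 0) \<and> (\<forall>i\<in>I. (\<Sum>j\<in>J. A i j * c j) = 0)"
  using assms
proof (induction I arbitrary: A J rule: finite_induct)
  case empty
  then have "J \<noteq> {}" by auto
  then show ?case by (intro exI[of _ "\<lambda>_. 1"]) auto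
next
  case (insert i I)
  show ?case
  proof (cases "\<forall>j\<in>J. A i j = 0")
    case True
    from insert.prems insert.hyps have "card I < card J" by simp
    with insert.IH[of J A] insert.prems True show ?thesis by auto
  next
    case False
    then obtain k where k: "k \<in> J" "A i k \<noteq> 0" by blast
    define J' where "J' = J - {k}"
    have J: "J = insert k J'" "k \<notin> J'" "finite J'"
      using k insert.prems by (auto simp: J'_def)
    have "card I < card J'"
      using insert.prems insert.hyps J by simp
    from insert.IH[OF J(3) this, of "\<lambda>l j. A l j - A l k / A i k * A i j"]
    obtain c where c: "\<exists>j\<in>J'. c j \<noteq> 0"
      "\<And>l. l \<in> I \<Longrightarrow> (\<Sum>j\<in>J'. (A l j - A l k / A i k * A i j) * c j) = 0" by blast
    define s where "s = (\<Sum>j\<in>J'. A i j * c j)"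
    \<comment> \<open>The value at \<open>k\<close> is the one that makes equation \<open>i\<close>
      hold.\<close>
    define c' where "c' = c(k := - s / A i k)"
    have sum: "(\<Sum>j\<in>J. A l j * c' j) = (\<Sum>j\<in>J'. A l j * c j) - A l k / A i k * s" for l
    proof -
      have "(\<Sum>j\<in>J'. A l j * c' j) = (\<Sum>j\<in>J'. A l j * c j)"
        using J(2) by (intro sum.cong) (auto simp: c'_def)
      then show ?thesis using J by (simp add: c'_def)
    qed
    have "(\<Sum>j\<in>J. A l j * c' j) = 0" if "l \<in> insert i I" for l
    proof (cases "l = i")
      case True
      then show ?thesis using k by (simp add: sum s_def)
    next
      case False
      with that have "l \<in> I" by simp
      have "(\<Sum>j\<in>J'. (A l j - A l k / A i k * A i j) * c j) = (\<Sum>j\<in>J'. A l j * c j) - A l k / A i k * s"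
        unfolding s_def sum_distrib_left sum_subtractf[symmetric] by (simp add: left_diff_distrib mult.assoc)
      with c(2)[OF \<open>l \<in> I\<close>] show ?thesis by (simp add: sum)
    qed
    moreover have "\<exists>j\<in>J. c' j \<noteq> 0"
      using c(1) J by (auto simp: c'_def)
    ultimately show ?thesis by blast
  qed
qed

text \<open>Stated with degree bounds instead of degrees, since the coefficients at the bounds may
  vanish on special lines.\<close>

lemma coeff_mult_degree_bound:
  assumes "degree p \<le> a" "degree q \<le> b"
  shows "coeff (p * q) (a + b) = coeff p a * coeff q b"
proof -
  have "coeff (p * q) (a + b) = (\<Sum>i\<le>a + b. if i = a then coeff p a * coeff q b else 0)"
    unfolding coeff_mult
  proof (intro sum.cong refl)
    fix i assume "i \<in> {..a + b}"
    consider "i = a" | "i > a" | "i < a" by linarith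
    then show "coeff p i * coeff q (a + b - i) = (if i = a then coeff p a * coeff q b else 0)"
      by cases (use assms in \<open>auto simp: coeff_eq_0\<close>)
  qed
  then show ?thesis by simp
qed

text \<open>The restriction to a line is a product of linear factors \<open>[:a v, w v:]\<close>,
  and the coefficients at the degree bounds multiply. The resulting coefficient depends only on the
  direction \<open>w\<close>, not on the base point \<open>a\<close>.\<close>

lemma monomial_eval_on_line:
  "\<exists>u. degree u \<le> mdeg m \<and> coeff u (mdeg m) = monomial_eval m w \<and>
     (\<forall>t. poly u t = monomial_eval m (\<lambda>v. a v + t * w v))"
proof -
  have "\<exists>u. degree u \<le> (\<Sum>v\<in>V. e v) \<and> coeff u (\<Sum>v\<in>V. e v) = (\<Prod>v\<in>V. w v ^ e v) \<and>
     (\<forall>t. poly u t = (\<Prod>v\<in>V. (a v + t * w v) ^ e v))" if "finite V" for V and e :: "'a \<Rightarrow> nat"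
    using that
  proof (induction V rule: finite_induct)
    case empty
    show ?case by (intro exI[of _ 1]) auto
  next
    case (insert v V)
    then obtain u where u: "degree u \<le> (\<Sum>v\<in>V. e v)" "coeff u (\<Sum>v\<in>V. e v) = (\<Prod>v\<in>V. w v ^ e v)"
      "\<And>t. poly u t = (\<Prod>v\<in>V. (a v + t * w v) ^ e v)" by blast
    have l: "degree ([:a v, w v:] ^ k) \<le> k \<and> coeff ([:a v, w v:] ^ k) k = w v ^ k" for k
    proof (induction k)
      case (Suc k)
      have "degree [:a v, w v:] \<le> 1" by simp
      then have "coeff ([:a v, w v:] * [:a v, w v:] ^ k) (1 + k) = w v * w v ^ k"
        using Suc by (subst coeff_mult_degree_bound) auto
      moreover have "degree ([:a v, w v:] * [:a v, w v:] ^ k) \<le> 1 + k"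
        using Suc \<open>degree [:a v, w v:] \<le> 1\<close> by (intro order_trans[OF degree_mult_le] add_mono) auto
      ultimately show ?case by (simp del: mult_pCons_left)
    qed simp
    show ?case
    proof (intro exI[of _ "[:a v, w v:] ^ e v * u"] conjI allI)
      show "degree ([:a v, w v:] ^ e v * u) \<le> (\<Sum>v\<in>insert v V. e v)"
        using insert.hyps l u(1) by (simp add: order_trans[OF degree_mult_le] add_mono)
      show "coeff ([:a v, w v:] ^ e v * u) (\<Sum>v\<in>insert v V. e v) = (\<Prod>v\<in>insert v V. w v ^ e v)"
        using insert.hyps l u(1,2) by (simp add: coeff_mult_degree_bound)
      show "poly ([:a v, w v:] ^ e v * u) t = (\<Prod>v\<in>insert v V. (a v + t * w v) ^ e v)" for t
        using insert.hyps u(3) by (simp add: poly_power)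
    qed
  qed
  then show ?thesis unfolding mdeg_def monomial_eval_def by simp
qed

text \<open>The coefficient at \<open>D\<close> is the homogeneous part of \<open>p\<close> of
  degree \<open>D\<close> at the direction \<open>w\<close>, since monomials of lower degree do not
  reach it.\<close>

lemma poly_eval_on_line:
  assumes "total_degree_le D p"
  obtains u where "degree u \<le> D"
    "coeff u D = (\<Sum>m | m \<in> Poly_Mapping.keys p \<and> mdeg m = D. Poly_Mapping.lookup p m * monomial_eval m w)"
    "\<And>t. poly u t = poly_eval p (\<lambda>v. a v + t * w v)"
proof -
  let ?K = "Poly_Mapping.keys p" and ?c = "Poly_Mapping.lookup p"
  obtain U where U: "\<And>m. degree (U m) \<le> mdeg m" "\<And>m. coeff (U m) (mdeg m) = monomial_eval m w"
    "\<And>m t. poly (U m) t = monomial_eval m (\<lambda>v. a v + t * w v)"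
    using monomial_eval_on_line[of _ w a] by metis
  let ?u = "\<Sum>m\<in>?K. smult (?c m) (U m)"
  show ?thesis
  proof
    have le: "mdeg m \<le> D" if "m \<in> ?K" for m
      using assms that by (auto simp: total_degree_le_def)
    then show "degree ?u \<le> D"
      by (intro degree_sum_le) (auto intro: order_trans[OF degree_smult_le] order_trans[OF U(1)])
    have "coeff ?u D = (\<Sum>m\<in>?K. if mdeg m = D then ?c m * monomial_eval m w else 0)"
      unfolding coeff_sum coeff_smult
    proof (intro sum.cong refl)
      fix m assume "m \<in> ?K"
      show "?c m * coeff (U m) D = (if mdeg m = D then ?c m * monomial_eval m w else 0)"
      proof (cases "mdeg m = D")
        case False
        with le[OF \<open>m \<in> ?K\<close>] U(1)[of m] have "degree (U m) < D" by linarith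
        with False show ?thesis by (simp add: coeff_eq_0)
      qed (use U(2) in auto)
    qed
    then show "coeff ?u D = (\<Sum>m | m \<in> ?K \<and> mdeg m = D. ?c m * monomial_eval m w)"
      by (simp add: sum.If_cases Int_def)
    show "poly ?u t = poly_eval p (\<lambda>v. a v + t * w v)" for t
      by (simp add: poly_sum U(3) poly_eval_superset[OF finite_keys order_refl])
  qed
qed

text \<open>Uniqueness of the expansion in base \<open>u\<close>: \<open>u\<close> divides
  \<open>r 0\<close>, which has smaller degree, so \<open>r 0 = 0\<close>; then one factor
  \<open>u\<close> cancels.\<close>

lemma low_degree_coefficients_eq_0:
  fixes u :: "'a::idom poly"
  assumes "(\<Sum>j<k. r j * u ^ j) = 0" "\<And>j. j < k \<Longrightarrow> degree (r j) < degree u" "j < k"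
  shows "r j = 0"
  using assms
proof (induction k arbitrary: r j)
  case (Suc k)
  let ?s = "\<Sum>j<k. r (Suc j) * u ^ j"
  have "(\<Sum>j<Suc k. r j * u ^ j) = r 0 + u * ?s"
    by (simp add: sum.lessThan_Suc_shift sum_distrib_left mult_ac del: sum.lessThan_Suc)
  with Suc.prems(1) have *: "r 0 + u * ?s = 0" by simp
  then have "r 0 = u * (- ?s)" by (simp add: eq_neg_iff_add_eq_0)
  then have "u dvd r 0" by (rule dvdI)
  then have r0: "r 0 = 0" using Suc.prems(2)[of 0] dvd_imp_degree_le[of u "r 0"] by fastforce
  have "u \<noteq> 0" using Suc.prems(2)[of 0] by auto
  with * r0 have "?s = 0" by simp
  then have "r (Suc i) = 0" if "i < k" for i
    using Suc.IH[of "\<lambda>j. r (Suc j)" i] Suc.prems(2) that by simp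
  with r0 Suc.prems(3) show ?case by (cases j) auto
qed simp

text \<open>If \<open>g\<close> had degree \<open>D > N\<close>, then on all lines in a direction
  where its top form is nonzero it would have degree exactly \<open>D\<close>, while the
  coefficients of the relation have degree at most \<open>N\<close> there. The expansion in base
  \<open>g\<close> then forces every coefficient to vanish on all these lines.\<close>

lemma total_degree_le_if_relation:
  fixes g :: "'v::finite cpoly" and p :: "nat \<Rightarrow> 'v cpoly"
  assumes rel: "\<And>y. (\<Sum>k<K. poly_eval (p k) y * poly_eval g y ^ k) = 0"
    and deg: "\<And>k. k < K \<Longrightarrow> total_degree_le N (p k)"
    and k: "k < K" "p k \<noteq> 0"
  shows "total_degree_le N g"
proof (rule ccontr)
  assume "\<not> total_degree_le N g"
  then obtain m0 where m0: "m0 \<in> Poly_Mapping.keys g" "mdeg m0 > N"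
    by (auto simp: total_degree_le_def not_le)
  define D where "D = Max (mdeg ` Poly_Mapping.keys g)"
  have D: "mdeg m \<le> D" if "m \<in> Poly_Mapping.keys g" for m
    using that by (simp add: D_def)
  then have degD: "total_degree_le D g" by (auto simp: total_degree_le_def)
  from m0 D have "N < D" by (meson less_le_trans)
  have "D \<in> mdeg ` Poly_Mapping.keys g"
    unfolding D_def using m0 by (intro Max_in) auto
  then obtain m1 where m1: "m1 \<in> Poly_Mapping.keys g" "mdeg m1 = D" by blast
  let ?top = "\<lambda>w. \<Sum>m | m \<in> Poly_Mapping.keys g \<and> mdeg m = D. Poly_Mapping.lookup g m * monomial_eval m w"
  obtain w where w: "?top w \<noteq> 0"
  proof (rule ccontr)
    assume "\<not> thesis"
    then have "?top w = 0" for w using that by blast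
    then have "Poly_Mapping.lookup g m1 = 0"
      using m1 power_products_independent[of UNIV "{m. m \<in> Poly_Mapping.keys g \<and> mdeg m = D}" Poly_Mapping.lookup
        "Poly_Mapping.lookup g" m1]
      by (simp add: monomial_eval_UNIV poly_mapping_eqI)
    with m1 show False by (simp add: in_keys_iff)
  qed
  have "poly_eval (p k) a = 0" for a
  proof -
    obtain u where u: "degree u \<le> D" "coeff u D = ?top w"
      "\<And>t. poly u t = poly_eval g (\<lambda>v. a v + t * w v)"
      by (rule poly_eval_on_line[OF degD, of w a]) blast
    have "degree u = D" using u(1,2) w by (simp add: le_antisym le_degree)
    have "\<exists>r. degree r \<le> N \<and> (\<forall>t. poly r t = poly_eval (p k) (\<lambda>v. a v + t * w v))" if "k < K" for k
      by (rule poly_eval_on_line[OF deg[OF that], of w a]) blast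
    then obtain r where r: "\<And>k. k < K \<Longrightarrow> degree (r k) \<le> N"
      "\<And>k t. k < K \<Longrightarrow> poly (r k) t = poly_eval (p k) (\<lambda>v. a v + t * w v)" by metis
    have "poly (\<Sum>k<K. r k * u ^ k) t = 0" for t
      using rel[of "\<lambda>v. a v + t * w v"] by (simp add: poly_sum poly_power r(2) u(3))
    then have "(\<Sum>k<K. r k * u ^ k) = 0" using poly_all_0_iff_0 by blast
    then have "r k = 0"
      by (rule low_degree_coefficients_eq_0) (use r(1) k \<open>degree u = D\<close> \<open>N < D\<close> in \<open>auto intro: le_less_trans\<close>)
    \<comment> \<open>At \<open>t = 0\<close> the line passes through \<open>a\<close>, and
      \<open>a\<close> is arbitrary while \<open>w\<close> is fixed.\<close>
    with r(2)[OF k(1), of 0] show ?thesis by simp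
  qed
  with k(2) poly_eval_eq_0_imp_0 show False by blast
qed

section \<open>Counting monomials and bounding the inverse\<close>

lemma card_monomials_of_degree_le:
  "card (monomials_of_degree_le D :: 'n::finite monomial set) \<le> (D + 1) ^ CARD('n)"
proof -
  have "card (monomials_of_degree_le D :: 'n monomial set) \<le> card ((UNIV :: 'n set) \<rightarrow>\<^sub>E {..D})"
  proof (rule card_inj_on_le[of Poly_Mapping.lookup])
    show "inj_on Poly_Mapping.lookup (monomials_of_degree_le D :: 'n monomial set)"
      by (auto simp: inj_on_def intro: poly_mapping_eqI)
    show "Poly_Mapping.lookup ` (monomials_of_degree_le D :: 'n monomial set) \<subseteq> UNIV \<rightarrow>\<^sub>E {..D}"
    proof -
      have "Poly_Mapping.lookup m v \<le> mdeg m" for m :: "'n monomial" and v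
        by (simp add: mdeg_superset[of UNIV] member_le_sum)
      then show ?thesis by (auto simp: monomials_of_degree_le_def intro: order_trans)
    qed
  qed (auto intro: finite_PiE)
  then show ?thesis by (simp add: card_funcsetE)
qed

lemma finite_monomials_of_degree_le [simp]: "finite (monomials_of_degree_le D :: 'n::finite monomial set)"
  by (simp add: monomials_of_degree_le_def finite_mdeg_le)

lemma inverse_degree_le:
  fixes F G :: "'n::finite polymap"
  assumes F: "F \<in> Omega d"
    and FG: "\<And>y i. poly_eval (F $ i) (\<lambda>j. poly_eval (G $ j) y) = y i"
  shows "total_degree_le (CARD('n) * (1 + CARD('n) * d) ^ CARD('n)) (G $ i)"
proof -
  let ?n = "CARD('n)"
  \<comment> \<open>\<open>K\<close> is chosen so that \<open>(K+1)\<^sup>n\<^sup>+\<^sup>1\<close>, the number of products \<open>x\<^sub>i\<^sup>k F\<^sup>\<alpha>\<close> with all exponents at most \<open>K\<close>,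
    exceeds \<open>((K+1)(1+nd))\<^sup>n\<close>, a bound for the number of monomials occurring in them.\<close>
  define K where "K = (1 + ?n * d) ^ ?n"
  define A where "A = ((UNIV :: 'n set) \<rightarrow>\<^sub>E {..K})"
  define J where "J = {..<Suc K} \<times> A"
  define I where "I = (monomials_of_degree_le (K + ?n * K * d) :: 'n monomial set)"
  have finA: "finite A" by (auto simp: A_def intro: finite_PiE)
  then have finJ: "finite J" by (simp add: J_def)
  have sum_le: "(\<Sum>v\<in>UNIV. \<alpha> v) \<le> ?n * K" if "\<alpha> \<in> A" for \<alpha>
    using sum_bounded_above[of UNIV \<alpha> K] that by (auto simp: A_def PiE_def Pi_def)
  have "card I \<le> (K + ?n * K * d + 1) ^ ?n"
    unfolding I_def by (rule card_monomials_of_degree_le)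
  also have "\<dots> \<le> (Suc K * (1 + ?n * d)) ^ ?n"
    by (intro power_mono) (simp_all add: algebra_simps del: One_nat_def)
  also have "\<dots> = Suc K ^ ?n * K" unfolding power_mult_distrib by (simp add: K_def)
  also have "\<dots> < card J"
    by (simp add: J_def A_def card_cartesian_product card_funcsetE)
  finally have card: "card I < card J" .

  define h where "h = (\<lambda>(k, \<alpha>) (a :: 'n \<Rightarrow> complex). a i ^ k * (\<Prod>v\<in>UNIV. poly_eval (F $ v) a ^ \<alpha> v))"
  have "cpoly_function I (h j)" if "j \<in> J" for j
  proof -
    from that obtain k \<alpha> where j: "j = (k, \<alpha>)" "k \<le> K" "\<alpha> \<in> A"
      unfolding J_def by (metis SigmaE lessThan_iff less_Suc_eq_le)
    have F': "cpoly_function (monomials_of_degree_le d) (poly_eval (F $ v))" for v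
      using F by (auto simp: Omega_def total_degree_le_iff intro: cpoly_function_poly_eval)
    have "cpoly_function (monomials_of_degree_le (k * 1)) (\<lambda>a. a i ^ k)"
      by (intro cpoly_function_degree_power cpoly_function_var) (simp add: monomials_of_degree_le_def)
    moreover have "cpoly_function (monomials_of_degree_le (\<Sum>v\<in>UNIV. \<alpha> v * d))
        (\<lambda>a. \<Prod>v\<in>UNIV. poly_eval (F $ v) a ^ \<alpha> v)"
      by (intro cpoly_function_degree_prod cpoly_function_degree_power F')
    moreover have le: "k * 1 + (\<Sum>v\<in>UNIV. \<alpha> v * d) \<le> K + ?n * K * d"
      using sum_le[OF j(3)] j(2) by (simp add: sum_distrib_right[symmetric] add_mono)
    ultimately show ?thesis
      unfolding h_def j prod.case I_def
      by (elim cpoly_function_mult) (use le in \<open>auto simp: monomials_of_degree_le_def mdeg_add\<close>)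
  qed
  then have "\<exists>P. Poly_Mapping.keys P \<subseteq> I \<and> (\<forall>a. poly_eval P a = h j a)" if "j \<in> J" for j
    using that by (auto simp: cpoly_function_def)
  then obtain P where P: "\<And>j. j \<in> J \<Longrightarrow> Poly_Mapping.keys (P j) \<subseteq> I"
    "\<And>j a. j \<in> J \<Longrightarrow> poly_eval (P j) a = h j a" by metis
  have "finite I" by (simp add: I_def)
  \<comment> \<open>One unknown for each product in \<open>J\<close>, one equation for each monomial
    in \<open>I\<close>: all coefficients of the combination must vanish.\<close>
  from nontrivial_solution[OF this finJ card, of "\<lambda>m j. Poly_Mapping.lookup (P j) m"]
  obtain c where c: "\<exists>j\<in>J. c j \<noteq> 0" "\<And>m. m \<in> I \<Longrightarrow> (\<Sum>j\<in>J. Poly_Mapping.lookup (P j) m * c j) = 0"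
    by blast
  have rel: "(\<Sum>j\<in>J. c j * h j a) = 0" for a
  proof -
    have "(\<Sum>j\<in>J. c j * h j a) =
        (\<Sum>j\<in>J. \<Sum>m\<in>I. Poly_Mapping.lookup (P j) m * c j * monomial_eval m a)"
    proof (intro sum.cong refl)
      fix j assume "j \<in> J"
      then have "h j a = (\<Sum>m\<in>I. Poly_Mapping.lookup (P j) m * monomial_eval m a)"
        using P poly_eval_superset[OF \<open>finite I\<close>] by metis
      then show "c j * h j a = (\<Sum>m\<in>I. Poly_Mapping.lookup (P j) m * c j * monomial_eval m a)"
        by (simp add: sum_distrib_left mult_ac)
    qed
    also have "\<dots> = (\<Sum>m\<in>I. (\<Sum>j\<in>J. Poly_Mapping.lookup (P j) m * c j) * monomial_eval m a)"
      unfolding sum_distrib_right by (rule sum.swap)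
    finally show ?thesis using c(2) by simp
  qed

  \<comment> \<open>With \<open>y\<close> standing for \<open>F(x)\<close>, this is the coefficient
    of the \<open>k\<close>-th power of the variable \<open>i\<close> in the relation.\<close>
  define q where "q = (\<lambda>k y. \<Sum>\<alpha>\<in>A. c (k, \<alpha>) * (\<Prod>v\<in>UNIV. y v ^ \<alpha> v))"
  have "cpoly_function (monomials_of_degree_le (?n * K)) (q k)" for k
    unfolding q_def
  proof (intro cpoly_function_sum cpoly_function_cmult)
    fix \<alpha> assume "\<alpha> \<in> A"
    have "cpoly_function (monomials_of_degree_le (\<Sum>v\<in>UNIV. \<alpha> v * 1)) (\<lambda>y. \<Prod>v\<in>UNIV. y v ^ \<alpha> v)"
      by (intro cpoly_function_degree_prod cpoly_function_degree_power cpoly_function_var) (simp add: monomials_of_degree_le_def)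
    then show "cpoly_function (monomials_of_degree_le (?n * K)) (\<lambda>y. \<Prod>v\<in>UNIV. y v ^ \<alpha> v)"
      by (rule cpoly_function_mono) (use sum_le[OF \<open>\<alpha> \<in> A\<close>] in \<open>auto simp: monomials_of_degree_le_def\<close>)
  qed
  then obtain Q where Q: "\<And>k. total_degree_le (?n * K) (Q k)" "\<And>k y. poly_eval (Q k) y = q k y"
    unfolding cpoly_function_def total_degree_le_iff by metis
  from c(1) obtain k \<alpha> where k: "k < Suc K" "\<alpha> \<in> A" "c (k, \<alpha>) \<noteq> 0" by (auto simp: J_def)
  have "Q k \<noteq> 0"
  proof
    assume "Q k = 0"
    then have "q k y = 0" for y using Q(2)[of k y] by simp
    then have "c (k, \<alpha>) = 0"
      unfolding q_def using k(2) finA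
      by (intro power_products_independent[of UNIV A "\<lambda>\<alpha>. \<alpha>" "\<lambda>\<alpha>. c (k, \<alpha>)" \<alpha>]) (auto simp: fun_eq_iff)
    with k(3) show False by simp
  qed
  have "total_degree_le (?n * K) (G $ i)"
  proof (rule total_degree_le_if_relation[where K = "Suc K" and p = Q])
    fix y
    \<comment> \<open>This is the relation at the point \<open>G(y)\<close>, where \<open>F\<close>
      takes the value \<open>y\<close> and the \<open>i\<close>-th coordinate is that of
      \<open>G(y)\<close>.\<close>
    have "(\<Sum>k<Suc K. poly_eval (Q k) y * poly_eval (G $ i) y ^ k) =
      (\<Sum>k<Suc K. \<Sum>\<alpha>\<in>A. c (k, \<alpha>) * h (k, \<alpha>) (\<lambda>j. poly_eval (G $ j) y))"
      unfolding Q(2) q_def h_def prod.case FG sum_distrib_right by (simp only: mult_ac)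
    also have "\<dots> = (\<Sum>j\<in>J. c j * h j (\<lambda>j. poly_eval (G $ j) y))"
      unfolding J_def sum.cartesian_product by (simp add: case_prod_unfold)
    finally show "(\<Sum>k<Suc K. poly_eval (Q k) y * poly_eval (G $ i) y ^ k) = 0"
      using rel by simp
  qed (use Q(1) k(1) \<open>Q k \<noteq> 0\<close> in auto)
  then show ?thesis by (simp add: K_def)
qed

section \<open>Closedness\<close>

lemma polynomial_automorphism_iff:
  fixes F :: "'n::finite polymap"
  shows "polynomial_automorphism F \<longleftrightarrow> (\<exists>G :: 'n polymap.
     (\<forall>a i. poly_eval (G $ i) (\<lambda>j. poly_eval (F $ j) a) = a i) \<and>
     (\<forall>a i. poly_eval (F $ i) (\<lambda>j. poly_eval (G $ j) a) = a i))"
proof -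
  have "polymap_fun G \<circ> polymap_fun F = id \<longleftrightarrow> (\<forall>a i. poly_eval (G $ i) (\<lambda>j. poly_eval (F $ j) a) = a i)"
    for F G :: "'n polymap"
  proof
    assume "polymap_fun G \<circ> polymap_fun F = id"
    then have "polymap_fun G (polymap_fun F (vec_lambda a)) $ i = a i" for a i
      by (metis comp_apply id_apply vec_lambda_beta)
    then show "\<forall>a i. poly_eval (G $ i) (\<lambda>j. poly_eval (F $ j) a) = a i"
      by (simp add: polymap_fun_def)
  qed (simp add: polymap_fun_def fun_eq_iff vec_eq_iff)
  then show ?thesis unfolding polynomial_automorphism_def by blast
qed

text \<open>The polynomial \<open>F_i(G(y)) - y_i\<close> vanishes at \<open>y = F(a)\<close> for
  all \<open>a\<close>, so algebraic independence of the components of \<open>F\<close> makes it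
  0.\<close>

lemma left_inverse_imp_right_inverse:
  fixes F G :: "'n::finite polymap"
  assumes "Jac F = 1" "\<And>a i. poly_eval (G $ i) (\<lambda>j. poly_eval (F $ j) a) = a i"
  shows "poly_eval (F $ i) (\<lambda>j. poly_eval (G $ j) y) = y i"
proof -
  have G: "cpoly_function (monomials_in UNIV) (poly_eval (G $ j))" for j
    by (rule cpoly_function_poly_eval) (simp add: monomials_in_def)
  have "cpoly_function (monomials_in UNIV) (\<lambda>y. poly_eval (F $ i) (\<lambda>j. poly_eval (G $ j) y) - y i)"
    unfolding poly_eval_superset[OF finite_keys order_refl, of "F $ i"] monomial_eval_UNIV
    by (intro cpoly_function_diff cpoly_function_sum cpoly_function_cmult
        cpoly_function_in_prod cpoly_function_in_power G cpoly_function_var) (simp add: monomials_in_def)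
  then obtain q where q: "\<And>y. poly_eval q y = poly_eval (F $ i) (\<lambda>j. poly_eval (G $ j) y) - y i"
    by (rule cpoly_functionE) blast
  have "q = 0"
    by (rule Jac_1_imp_algebraically_independent[OF assms(1)]) (simp add: q assms(2))
  with q[of y] show ?thesis by simp
qed

text \<open>A relation not involving the coordinate \<open>x i\<close> would be an algebraic
  relation between the components of \<open>F\<close>. Hence \<open>x i\<close> occurs with nonzero
  coefficient and can be solved for.\<close>

lemma linearly_dependent_iff_inverse_component:
  fixes F :: "'n::finite polymap"
  assumes "Jac F = 1" "distinct ms" "set ms = monomials_of_degree_le N"
  shows "linearly_dependent ((\<lambda>x. x i) # map (\<lambda>m x. monomial_eval m (\<lambda>v. poly_eval (F $ v) x)) ms) \<longleftrightarrow>
    (\<exists>g. total_degree_le N g \<and> (\<forall>a. poly_eval g (\<lambda>j. poly_eval (F $ j) a) = a i))" (is "?L \<longleftrightarrow> ?R")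
proof -
  let ?F = "\<lambda>a v. poly_eval (F $ v) a"
  have nth_sum: "(\<Sum>b<length ms. f (ms ! b)) = (\<Sum>m\<in>set ms. f m)" for f :: "'n monomial \<Rightarrow> complex"
    using assms(2) by (rule sum.reindex_bij_betw[OF bij_betw_nth]) auto
  show ?thesis
  proof
    assume ?L
    then obtain c0 c where c: "c0 \<noteq> 0 \<or> (\<exists>b<length ms. c b \<noteq> 0)"
      "\<And>x. c0 * x i + (\<Sum>b<length ms. c b * monomial_eval (ms ! b) (?F x)) = 0"
      unfolding linearly_dependent_Cons by auto
    define q where "q = (\<Sum>b<length ms. Poly_Mapping.single (ms ! b) (c b))"
    have q: "c0 * x i + poly_eval q (?F x) = 0" for x
      using c(2)[of x] by (simp add: q_def poly_eval_sum)
    \<comment> \<open>Since \<open>ms\<close> is distinct, no coefficients are merged in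
      \<open>q\<close>, so \<open>q = 0\<close> would make all \<open>c b\<close> vanish.\<close>
    have lookup_q: "Poly_Mapping.lookup q (ms ! b) = c b" if "b < length ms" for b
    proof -
      have "Poly_Mapping.lookup q (ms ! b) = (\<Sum>b'<length ms. if b' = b then c b else 0)"
        unfolding q_def lookup_sum
        by (intro sum.cong refl) (use that assms(2) in \<open>auto simp: lookup_single when_def nth_eq_iff_index_eq\<close>)
      then show ?thesis using that by simp
    qed
    have "c0 \<noteq> 0"
    proof
      assume "c0 = 0"
      with q have "q = 0" by (intro Jac_1_imp_algebraically_independent[OF assms(1)]) simp
      with lookup_q c(1) \<open>c0 = 0\<close> show False by auto
    qed
    have "Poly_Mapping.keys q \<subseteq> (\<Union>b<length ms. Poly_Mapping.keys (Poly_Mapping.single (ms ! b) (c b)))"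
      unfolding q_def by (rule keys_sum)
    then have keys_q: "Poly_Mapping.keys q \<subseteq> monomials_of_degree_le N"
      using assms(3) by (fastforce split: if_splits)
    let ?g = "Poly_Mapping.single 0 (- 1 / c0) * q"
    have "total_degree_le N ?g"
      unfolding total_degree_le_iff using keys_mult[of "Poly_Mapping.single 0 (- 1 / c0)" q] keys_q
      by (fastforce split: if_splits)
    moreover have "poly_eval ?g (?F a) = a i" for a
    proof -
      have "poly_eval q (?F a) = - (c0 * a i)" using q[of a] by (simp add: eq_neg_iff_add_eq_0 add.commute)
      then show ?thesis using \<open>c0 \<noteq> 0\<close> by (simp add: poly_eval_mult)
    qed
    ultimately show ?R by blast
  next
    assume ?R
    then obtain g where g: "total_degree_le N g" "\<And>a. poly_eval g (?F a) = a i" by blast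
    have "- 1 * x i + (\<Sum>b<length ms. Poly_Mapping.lookup g (ms ! b) * monomial_eval (ms ! b) (?F x)) = 0" for x
      using g assms(3) nth_sum[of "\<lambda>m. Poly_Mapping.lookup g m * monomial_eval m (?F x)"]
        poly_eval_superset[of "set ms" g "?F x"]
      by (simp add: total_degree_le_iff)
    then show ?L
      unfolding linearly_dependent_Cons
      by (intro exI[of _ "-1"] exI[of _ "\<lambda>b. Poly_Mapping.lookup g (ms ! b)"]) simp
  qed
qed

text \<open>The defining family is the whole vanishing ideal of \<open>S\<close>. So membership in
  \<open>S\<close> has to be derived from the polynomial conditions valid on \<open>S\<close>,
  chosen as needed, and no explicit system has to be assembled.\<close>

lemma zariski_closed_in_OmegaI:
  fixes S :: "'n::finite polymap set"
  assumes "S \<subseteq> Omega d"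
    and "\<And>F. F \<in> Omega d \<Longrightarrow>
      (\<And>f. cpoly_function (monomials_in (coeff_index d)) f \<Longrightarrow>
        (\<And>F'. F' \<in> S \<Longrightarrow> f (coeff_point d F') = 0) \<Longrightarrow> f (coeff_point d F) = 0) \<Longrightarrow> F \<in> S"
  shows "zariski_closed_in_Omega d S"
proof -
  define P where "P = {p :: ('n \<times> 'n monomial) cpoly. Poly_Mapping.keys p \<subseteq> monomials_in (coeff_index d) \<and>
    (\<forall>F\<in>S. poly_eval p (coeff_point d F) = 0)}"
  have range: "coeff_point d ` (Omega d :: 'n polymap set) = coeff_index d \<rightarrow>\<^sub>E UNIV"
    using coeff_point_bij_betw by (rule bij_betw_imp_surj_on)
  have "coeff_point d ` S = {a \<in> coeff_index d \<rightarrow>\<^sub>E UNIV. \<forall>p\<in>P. poly_eval p a = 0}"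
  proof
    show "coeff_point d ` S \<subseteq> {a \<in> coeff_index d \<rightarrow>\<^sub>E UNIV. \<forall>p\<in>P. poly_eval p a = 0}"
      using assms(1) by (auto simp: P_def simp flip: range)
    show "{a \<in> coeff_index d \<rightarrow>\<^sub>E UNIV. \<forall>p\<in>P. poly_eval p a = 0} \<subseteq> coeff_point d ` S"
    proof clarify
      fix a :: "'n \<times> 'n monomial \<Rightarrow> complex"
      assume "a \<in> coeff_index d \<rightarrow>\<^sub>E UNIV" and a: "\<forall>p\<in>P. poly_eval p a = 0"
      then obtain F where F: "F \<in> Omega d" "a = coeff_point d F" using range by blast
      have "F \<in> S"
      proof (rule assms(2)[OF F(1)])
        fix f assume "cpoly_function (monomials_in (coeff_index d)) f"
          and f: "\<And>F'. F' \<in> S \<Longrightarrow> f (coeff_point d F') = 0"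
        then obtain p where p: "Poly_Mapping.keys p \<subseteq> monomials_in (coeff_index d)" "\<And>a. poly_eval p a = f a"
          by (elim cpoly_functionE) blast
        then have "p \<in> P" by (simp add: P_def f)
        with a p(2) F(2) show "f (coeff_point d F) = 0" by metis
      qed
      with F(2) show "a \<in> coeff_point d ` S" by blast
    qed
  qed
  moreover have "\<forall>p\<in>P. \<forall>m\<in>Poly_Mapping.keys p. Poly_Mapping.keys m \<subseteq> coeff_index d"
    by (auto simp: P_def monomials_in_def)
  ultimately show ?thesis
    unfolding zariski_closed_in_Omega_def zariski_closed_def using assms(1) by blast
qed

text \<open>Replaces the support, which varies with \<open>F\<close>, by a fixed index set, so that
  the sum becomes a linear form in the coordinates. The weights \<open>\<mu>\<close> are values of
  monomials or of their derivatives.\<close>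

lemma coeff_point_sum:
  fixes F :: "'n::finite polymap" and \<mu> :: "'n monomial \<Rightarrow> complex"
  assumes "F \<in> Omega d"
  shows "(\<Sum>m\<in>Poly_Mapping.keys (F $ i). Poly_Mapping.lookup (F $ i) m * \<mu> m) =
    (\<Sum>m\<in>monomials_of_degree_le d. coeff_point d F (i, m) * \<mu> m)"
proof -
  have "(\<Sum>m\<in>Poly_Mapping.keys (F $ i). Poly_Mapping.lookup (F $ i) m * \<mu> m) =
    (\<Sum>m\<in>monomials_of_degree_le d. Poly_Mapping.lookup (F $ i) m * \<mu> m)"
    by (rule sum.mono_neutral_left) (use assms in \<open>auto simp: Omega_def total_degree_le_iff in_keys_iff\<close>)
  then show ?thesis
    by (simp add: coeff_point_def coeff_index_def monomials_of_degree_le_def)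
qed

lemma cpoly_function_coeff_sum:
  fixes \<mu> :: "'n::finite monomial \<Rightarrow> complex"
  shows "cpoly_function (monomials_in (coeff_index d)) (\<lambda>a. \<Sum>m\<in>monomials_of_degree_le d. a (i, m) * \<mu> m)"
proof (rule cpoly_function_sum)
  fix m :: "'n monomial" assume "m \<in> monomials_of_degree_le d"
  then have "cpoly_function (monomials_in (coeff_index d)) (\<lambda>a. \<mu> m * a (i, m))"
    by (intro cpoly_function_cmult cpoly_function_var)
      (simp add: monomials_in_def coeff_index_def monomials_of_degree_le_def)
  then show "cpoly_function (monomials_in (coeff_index d)) (\<lambda>a. a (i, m) * \<mu> m)"
    by (simp add: mult.commute)
qed

theorem lemma2p1:
  fixes d :: nat
  assumes "d \<ge> 1"
  shows "zariski_closed_in_Omega d (unimodular_automorphisms d :: 'n::finite polymap set)"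
proof (rule zariski_closed_in_OmegaI)
  show "(unimodular_automorphisms d :: 'n polymap set) \<subseteq> Omega d"
    by (auto simp: unimodular_automorphisms_def)
next
  fix F :: "'n polymap"
  assume F: "F \<in> Omega d" and
    vanish: "\<And>f. cpoly_function (monomials_in (coeff_index d)) f \<Longrightarrow>
      (\<And>F'. F' \<in> (unimodular_automorphisms d :: 'n polymap set) \<Longrightarrow> f (coeff_point d F') = 0) \<Longrightarrow>
      f (coeff_point d F) = 0"
  let ?N = "CARD('n) * (1 + CARD('n) * d) ^ CARD('n)"
  have "poly_eval (Jac F - 1) x = 0" for x
  proof -
    \<comment> \<open>For fixed \<open>x\<close>, the value of \<open>Jac F - 1\<close> at
      \<open>x\<close> as a polynomial in the coefficients of \<open>F\<close>.\<close>
    define D where "D = (\<lambda>a. det (\<chi> i j. \<Sum>m\<in>monomials_of_degree_le d. a (i, m) *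
       (of_nat (Poly_Mapping.lookup m j) * monomial_eval (m - Poly_Mapping.single j 1) x)) - 1)"
    have D: "poly_eval (Jac F' - 1) x = D (coeff_point d F')" if "F' \<in> Omega d" for F' :: "'n polymap"
      by (simp add: D_def poly_eval_diff poly_eval_Jac poly_eval_partial_deriv coeff_point_sum[OF that])
    have "D (coeff_point d F) = 0"
    proof (rule vanish)
      show "cpoly_function (monomials_in (coeff_index d)) D"
        unfolding D_def by (intro cpoly_function_diff cpoly_function_in_det cpoly_function_const)
          (simp_all add: cpoly_function_coeff_sum)
      fix F' :: "'n polymap" assume "F' \<in> unimodular_automorphisms d"
      then show "D (coeff_point d F') = 0"
        using D[of F'] by (simp add: unimodular_automorphisms_def)
    qed
    with D[OF F] show ?thesis by simp
  qed
  then have "Jac F - 1 = 0" by (rule poly_eval_eq_0_imp_0)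
  then have Jac: "Jac F = 1" by simp

  obtain ms where ms: "set ms = (monomials_of_degree_le ?N :: 'n monomial set)" "distinct ms"
    using finite_distinct_list[OF finite_monomials_of_degree_le] by blast
  have "\<exists>g. total_degree_le ?N g \<and> (\<forall>a. poly_eval g (\<lambda>j. poly_eval (F $ j) a) = a i)" for i
  proof -
    define L where "L = (\<lambda>F :: 'n polymap.
      (\<lambda>x. x i) # map (\<lambda>m x. monomial_eval m (\<lambda>v. poly_eval (F $ v) x)) ms)"
    have "eliminant (L F) ps = 0" for ps
    proof -
      \<comment> \<open>The functions of \<open>L\<close>, with the coefficients of the map replaced
        by free coordinates \<open>a\<close>.\<close>
      define fs where "fs = (\<lambda>a x. x i) # map (\<lambda>m a x. monomial_eval m
        (\<lambda>v. \<Sum>k\<in>monomials_of_degree_le d. a (v, k) * monomial_eval k x)) ms"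
      have L: "L F' = map (\<lambda>f. f (coeff_point d F')) fs" if "F' \<in> Omega d" for F' :: "'n polymap"
        by (simp add: L_def fs_def poly_eval_superset[OF finite_keys order_refl] coeff_point_sum[OF that])
      have "eliminant (map (\<lambda>f. f (coeff_point d F)) fs) ps = 0"
      proof (rule vanish)
        show "cpoly_function (monomials_in (coeff_index d)) (\<lambda>a. eliminant (map (\<lambda>f. f a) fs) ps)"
        proof (rule cpoly_function_in_eliminant)
          fix f and x :: "'n \<Rightarrow> complex" assume "f \<in> set fs"
          then consider "f = (\<lambda>a x. x i)"
            | m where "f = (\<lambda>a x. monomial_eval m
                (\<lambda>v. \<Sum>k\<in>monomials_of_degree_le d. a (v, k) * monomial_eval k x))"
            unfolding fs_def by auto
          then show "cpoly_function (monomials_in (coeff_index d)) (\<lambda>a. f a x)"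
          proof cases
            case 2
            then show ?thesis
              by (simp add: monomial_eval_UNIV[of m] cpoly_function_in_prod cpoly_function_in_power cpoly_function_coeff_sum)
          qed (simp add: cpoly_function_const)
        qed
        fix F' :: "'n polymap" assume "F' \<in> unimodular_automorphisms d"
        then have F': "F' \<in> Omega d" "Jac F' = 1" and "polynomial_automorphism F'"
          by (auto simp: unimodular_automorphisms_def)
        then obtain G where G: "\<And>a i. poly_eval (G $ i) (\<lambda>j. poly_eval (F' $ j) a) = a i"
          "\<And>a i. poly_eval (F' $ i) (\<lambda>j. poly_eval (G $ j) a) = a i"
          unfolding polynomial_automorphism_iff by blast
        \<comment> \<open>The uniform degree bound is what lets one fixed list \<open>ms\<close>
          serve all automorphisms in the set.\<close>
        have "total_degree_le ?N (G $ i)" by (rule inverse_degree_le[OF F'(1) G(2)])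
        then have "linearly_dependent (L F')"
          unfolding L_def linearly_dependent_iff_inverse_component[OF F'(2) ms(2,1)] using G(1) by blast
        then show "eliminant (map (\<lambda>f. f (coeff_point d F')) fs) ps = 0"
          by (simp add: eliminant_eq_0_if_linearly_dependent flip: L[OF F'(1)])
      qed
      then show ?thesis by (simp add: L[OF F])
    qed
    moreover have "L F \<noteq> []" by (simp add: L_def)
    \<comment> \<open>The converse direction of the criterion, at \<open>F\<close> itself;
      \<open>Jac F = 1\<close> then turns dependence into a component of a left inverse.\<close>
    ultimately have "linearly_dependent (L F)" by (simp add: linearly_dependent_iff_eliminant)
    then show ?thesis unfolding L_def linearly_dependent_iff_inverse_component[OF Jac ms(2,1)] .
  qed
  then obtain g where g: "\<And>i a. poly_eval (g i) (\<lambda>j. poly_eval (F $ j) a) = a i" by metis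
  define G :: "'n polymap" where "G = (\<chi> i. g i)"
  have GF: "poly_eval (G $ i) (\<lambda>j. poly_eval (F $ j) a) = a i" for a i by (simp add: G_def g)
  with left_inverse_imp_right_inverse[OF Jac GF] have "polynomial_automorphism F"
    unfolding polynomial_automorphism_iff by blast
  with F Jac show "F \<in> unimodular_automorphisms d" by (simp add: unimodular_automorphisms_def)
qed

end
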